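(* Let $\mathbf{A}\in\mathbb{R}^{d\times d}$ be symmetric, let $n\ge 0$ be an integer, let $c_0,\dots,c_n\in\mathbb{R}$, and let $\mathbf{z}\in\mathbb{R}^d$ be a Rademacher random vector. For integers $-1\le \ell'<\ell\le n$ let $$Q_{\ell'\ell}=\sum_{j=\ell'+1}^{\ell}c_j\,\mathbf{z}^T T_j(\mathbf{A})\mathbf{z},$$ let $V_{\ell'\ell}$ be the variance of $Q_{\ell'\ell}$, and let $C_{\ell'\ell}$ be the cost of sampling $Q_{\ell'\ell}$ (modeled as in the context, either by $C_{\ell'\ell}=\ell$ for all $\ell'<\ell$, or by $C_{\ell'\ell}=\lceil \ell/2\rceil$ for all $\ell'<\ell$). For $0\le \ell\le n$ define $$\mathcal{C}_\ell:=\min_{L}\ \min_{\{\ell_k\}}\ \sum_{k=1}^{L}\sqrt{V_{\ell_{k-1}\ell_k}\,C_{\ell_{k-1}\ell_k}},$$ where the minimum is over all integers $L\ge 1$ and all integer sequences satisfying $0\le \ell_1<\ell_2<\cdots<\ell_L=\ell$, with the convention $\ell_0=-1$. Then $\mathcal{C}_n$ can be computed by the recurrence $$\mathcal{C}_\ell=\begin{cases}0, & \ell=0,\\[2pt] \displaystyle\min_{0\le \ell'<\ell}\left(\mathcal{C}_{\ell'}+\sqrt{V_{\ell'\ell}\,C_{\ell'\ell}}\right), & 1\le \ell\le n,\end{cases}$$ that is, the quantities $\mathcal{C}_0,\dots,\mathcal{C}_n$ satisfy this recurrence.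
   Context: $T_j$ denotes the Chebyshev polynomial of the first kind: $T_0(x)=1$, $T_1(x)=x$, $T_{j+1}(x)=2xT_j(x)-T_{j-1}(x)$ for $j\ge 1$; in particular $T_0(\mathbf{A})=\mathbf{I}$. The coefficients $c_0,\dots,c_n$ are those of a degree-$n$ Chebyshev interpolant $p_n(x)=\sum_{j=0}^n c_jT_j(x)$ of a function $f$ on $[-1,1]$. A Rademacher vector is a random vector whose entries are independent and equal to $\pm1$ with probability $1/2$ each. The cost of sampling $Q_{\ell'\ell}$ is modeled by the number of matrix-vector products with $\mathbf{A}$ required, which is taken to be $\ell$ or, when the symmetry of the quadratic form is exploited, $\lceil \ell/2\rceil$; one of these two models is fixed throughout. *)

theory Defs
  imports "HOL-Probability.Probability" "HOL-Computational_Algebra.Polynomial"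
begin

fun chebyshev :: "nat \<Rightarrow> real poly" where
  "chebyshev 0 = 1"
| "chebyshev (Suc 0) = [:0, 1:]"
| "chebyshev (Suc (Suc j)) = smult 2 ([:0, 1:] * chebyshev (Suc j)) - chebyshev j"

(* The class operations times and power on vectors are componentwise, so the power operator
   applied to A is not the matrix power; powers are iterates of the matrix product instead. *)
definition mat_power :: "real^'d^'d \<Rightarrow> nat \<Rightarrow> real^'d^'d" where
  "mat_power A k = (((**) A) ^^ k) (mat 1)"

definition poly_mat :: "real poly \<Rightarrow> real^'d^'d \<Rightarrow> real^'d^'d" where
  "poly_mat p A = (\<Sum>i\<le>degree p. coeff p i *\<^sub>R mat_power A i)"

(* Measurability of the entries is part of the library notion indep_vars. *)
definition rademacher_vector :: "'w measure \<Rightarrow> ('w \<Rightarrow> real^'d) \<Rightarrow> bool" where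
  "rademacher_vector M z \<longleftrightarrow>
     prob_space.indep_vars M (\<lambda>_. borel) (\<lambda>i \<omega>. z \<omega> $ i) UNIV \<and>
     (\<forall>i. measure M {\<omega> \<in> space M. z \<omega> $ i = 1} = 1/2 \<and>
          measure M {\<omega> \<in> space M. z \<omega> $ i = - 1} = 1/2)"

(* Levels are integers because the bottom level is -1. *)
definition level_diff ::
  "(nat \<Rightarrow> real) \<Rightarrow> real^'d^'d \<Rightarrow> ('w \<Rightarrow> real^'d) \<Rightarrow> int \<Rightarrow> int \<Rightarrow> 'w \<Rightarrow> real" where
  "level_diff c A z l' l \<omega> =
     (\<Sum>j = l' + 1..l. c (nat j) * (z \<omega> \<bullet> (poly_mat (chebyshev (nat j)) A *v z \<omega>)))"

definition level_var ::
  "'w measure \<Rightarrow> (nat \<Rightarrow> real) \<Rightarrow> real^'d^'d \<Rightarrow> ('w \<Rightarrow> real^'d) \<Rightarrow> int \<Rightarrow> int \<Rightarrow> real" where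
  "level_var M c A z l' l = prob_space.variance M (level_diff c A z l' l)"

definition admissible_levels :: "int \<Rightarrow> nat \<Rightarrow> (nat \<Rightarrow> int) \<Rightarrow> bool" where
  "admissible_levels l L s \<longleftrightarrow>
     1 \<le> L \<and> s 0 = - 1 \<and> 0 \<le> s 1 \<and> (\<forall>k\<in>{1..<L}. s k < s (Suc k)) \<and> s L = l"

(* The iterated minimum over L and over level sequences is a single minimum over all pairs.
   Only the values of s on 0..L matter and L is at most l + 1, so for l >= 0 the set is
   finite and nonempty, as Min requires. *)
definition opt_cost :: "(int \<Rightarrow> int \<Rightarrow> real) \<Rightarrow> (int \<Rightarrow> int \<Rightarrow> real) \<Rightarrow> int \<Rightarrow> real" where
  "opt_cost V C l =
     Min {(\<Sum>k = 1..L. sqrt (V (s (k - 1)) (s k) * C (s (k - 1)) (s k))) | L s.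
            admissible_levels l L s}"

end

theory Submission
  imports Defs
begin

text \<open>
  Cutting off the last jump shows that a level sequence ending in \<open>l\<close> is either the single jump
  from \<open>-1\<close> to \<open>l\<close>, or a sequence ending in some \<open>l' < l\<close> followed by a jump from \<open>l'\<close> to \<open>l\<close>.
  The recurrence omits the single jump, which is harmless: since \<open>z\<^sup>T T\<^sub>0(A) z = z\<^sup>T z\<close> is almost
  surely the constant \<open>d\<close>, the variances from \<open>-1\<close> and from \<open>0\<close> to \<open>l\<close> agree, and sampling
  level \<open>0\<close> is free, so passing through \<open>0\<close> costs the same as jumping directly.
\<close>

text \<open>Arbitrary edge weights \<open>w\<close> separate the dynamic programming from
  probability: levels are vertices, and the optimal cost is a shortest path from -1.\<close>

definition path_costs :: "(int \<Rightarrow> int \<Rightarrow> real) \<Rightarrow> int \<Rightarrow> real set" where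
  "path_costs w l = {(\<Sum>k = 1..L. w (s (k - 1)) (s k)) | L s. admissible_levels l L s}"

lemma opt_cost_eq: "opt_cost V C l = Min (path_costs (\<lambda>i j. sqrt (V i j * C i j)) l)"
  by (simp add: opt_cost_def path_costs_def)

text \<open>The sequence increases from \<open>s 1\<close> on. Hence the level left after cutting
  off the last jump lies in \<open>{0..<l}\<close>, the range of the recurrence.\<close>

lemma admissible_levels_nonneg:
  assumes "admissible_levels l L s" "1 \<le> k" "k \<le> L"
  shows "0 \<le> s k"
  using assms(2,3)
proof (induction k rule: dec_induct)
  case base
  then show ?case using assms(1) by (simp add: admissible_levels_def)
next
  case (step k)
  then have "s k < s (Suc k)"
    using assms(1) by (simp add: admissible_levels_def)
  with step show ?case by simp
qed

lemma path_costs_rec: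
  assumes "0 \<le> l"
  shows "path_costs w l =
    insert (w (- 1) l) (\<Union>l'\<in>{0..<l}. (\<lambda>x. x + w l' l) ` path_costs w l')" (is "_ = ?R")
proof (intro equalityI subsetI)
  fix x assume "x \<in> path_costs w l"
  then obtain L s where adm: "admissible_levels l L s"
    and x: "x = (\<Sum>k = 1..L. w (s (k - 1)) (s k))"
    by (auto simp: path_costs_def)
  from adm have "L = 1 \<or> 2 \<le> L" by (auto simp: admissible_levels_def)
  then show "x \<in> ?R"
  proof
    assume "L = 1"
    with adm x show ?thesis by (simp add: admissible_levels_def)
  next
    assume "2 \<le> L"
    then obtain K where K: "L = Suc K" "1 \<le> K" by (cases L) auto
    have "0 \<le> s K" using admissible_levels_nonneg[OF adm] K by simp
    \<comment> \<open>The same \<open>s\<close> serves for the shortened sequence, since entries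
      beyond index \<open>K\<close> are unconstrained.\<close>
    moreover have "s K < l" "s (Suc K) = l" "admissible_levels (s K) K s"
      using adm K by (auto simp: admissible_levels_def)
    moreover have "x = (\<Sum>k = 1..K. w (s (k - 1)) (s k)) + w (s K) l"
      using x K \<open>s (Suc K) = l\<close> by simp
    ultimately show ?thesis unfolding path_costs_def by fastforce
  qed
next
  fix x assume "x \<in> ?R"
  then consider "x = w (- 1) l"
    | l' L s where "0 \<le> l'" "l' < l" "admissible_levels l' L s"
        "x = (\<Sum>k = 1..L. w (s (k - 1)) (s k)) + w l' l"
    by (auto simp: path_costs_def)
  then show "x \<in> path_costs w l"
  proof cases
    case 1
    have "admissible_levels l 1 (\<lambda>k. if k = 0 then - 1 else l)"
      using assms by (simp add: admissible_levels_def)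
    then show ?thesis
      unfolding path_costs_def using 1 by force
  next
    case (2 l' L s)
    \<comment> \<open>Only the entry after the end of \<open>s\<close> is overwritten, so the first
      \<open>L\<close> jumps keep their cost and the new one starts at
      \<open>s L = l'\<close>.\<close>
    let ?s = "s(Suc L := l)"
    have "admissible_levels l (Suc L) ?s"
      using 2 by (auto simp: admissible_levels_def less_Suc_eq)
    moreover have "(\<Sum>k = 1..L. w (?s (k - 1)) (?s k)) = (\<Sum>k = 1..L. w (s (k - 1)) (s k))"
      by (rule sum.cong) auto
    then have "x = (\<Sum>k = 1..Suc L. w (?s (k - 1)) (?s k))"
      using 2 by (simp add: admissible_levels_def)
    ultimately show ?thesis unfolding path_costs_def by blast
  qed
qed

text \<open>The admissible sequences themselves form an infinite set, because values beyond
  \<open>L\<close> are free. Finiteness of their costs comes from the decomposition instead, by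
  strong induction on the level.\<close>

lemma finite_path_costs: "0 \<le> l \<Longrightarrow> finite (path_costs w l)"
proof (induction "nat l" arbitrary: l rule: less_induct)
  case less
  then have "finite (path_costs w l')" if "l' \<in> {0..<l}" for l'
    using that by auto
  with less.prems show ?case by (simp add: path_costs_rec[of l])
qed

lemma path_costs_nonempty: "0 \<le> l \<Longrightarrow> path_costs w l \<noteq> {}"
  by (simp add: path_costs_rec[of l])

lemma Min_path_costs_0: "Min (path_costs w 0) = w (- 1) 0"
  by (simp add: path_costs_rec[of 0])

lemma Min_path_costs_rec:
  assumes "0 < l" and detour: "w (- 1) 0 + w 0 l \<le> w (- 1) l"
  shows "Min (path_costs w l) = Min ((\<lambda>l'. Min (path_costs w l') + w l' l) ` {0..<l})"
    (is "_ = Min ?R")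
proof (rule Min_eqI)
  have le: "Min (path_costs w l') \<le> x" if "x \<in> path_costs w l'" "0 \<le> l'" for x l'
    using that finite_path_costs by simp
  have R: "Min ?R \<le> Min (path_costs w l') + w l' l" if "l' \<in> {0..<l}" for l'
    using that by (intro Min_le) auto
  show "finite (path_costs w l)" using assms finite_path_costs by simp
  show "Min ?R \<le> y" if "y \<in> path_costs w l" for y
  proof -
    from that assms(1) consider "y = w (- 1) l"
      | l' x where "l' \<in> {0..<l}" "x \<in> path_costs w l'" "y = x + w l' l"
      by (auto simp: path_costs_rec[of l])
    then show ?thesis
    proof cases
      case 1
      \<comment> \<open>The only path to level 0 is the jump from -1, so the candidate for
        \<open>l' = 0\<close> is exactly the left side of \<open>detour\<close>.\<close>
      with R[of 0] assms show ?thesis by (simp add: Min_path_costs_0)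
    next
      case (2 l' x)
      with le[of x l'] have "Min (path_costs w l') + w l' l \<le> y" by simp
      with R[OF 2(1)] show ?thesis by (rule order_trans)
    qed
  qed
  \<comment> \<open>Both minima are attained: an optimal path to an optimal \<open>l'\<close>,
    extended by a jump to \<open>l\<close>, realizes \<open>Min ?R\<close>.\<close>
  have "Min ?R \<in> ?R" using assms(1) by (intro Min_in) auto
  then obtain l' where l': "l' \<in> {0..<l}" "Min ?R = Min (path_costs w l') + w l' l" by blast
  moreover from l' have "Min (path_costs w l') \<in> path_costs w l'"
    by (intro Min_in) (auto simp: finite_path_costs path_costs_nonempty)
  ultimately show "Min ?R \<in> path_costs w l"
    using assms(1) by (auto simp: path_costs_rec[of l])
qed

lemma poly_mat_1: "poly_mat 1 A = mat 1"
  by (simp add: poly_mat_def mat_power_def)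

text \<open>The shift moves the mean by \<open>a\<close> as well, so the centred variables agree
  almost everywhere.\<close>

lemma (in prob_space) variance_add_const_AE:
  fixes X Y :: "'a \<Rightarrow> real"
  assumes X: "integrable M X" and Y: "Y \<in> borel_measurable M"
    and eq: "AE \<omega> in M. Y \<omega> = a + X \<omega>"
  shows "variance Y = variance X"
proof -
  have "expectation Y = expectation (\<lambda>\<omega>. a + X \<omega>)"
    using X Y eq by (intro integral_cong_AE) auto
  also have "\<dots> = a + expectation X"
    using X by (simp add: prob_space)
  finally have E: "expectation Y = a + expectation X" .
  show ?thesis
    unfolding E using X Y eq by (intro integral_cong_AE) (auto simp: algebra_simps)
qed

context prob_space
begin

text \<open>The events that an entry is 1 and that it is -1 are disjoint and have mass 1/2 each,
  which exhausts the total mass. There are finitely many entries, so one null set covers all of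
  them.\<close>

lemma rademacher_AE:
  fixes z :: "'a \<Rightarrow> real^'d"
  assumes "rademacher_vector M z"
  shows "AE \<omega> in M. \<forall>i. \<bar>z \<omega> $ i\<bar> = 1"
proof -
  have "AE \<omega> in M. \<bar>z \<omega> $ i\<bar> = 1" for i
  proof -
    let ?P = "{\<omega> \<in> space M. z \<omega> $ i = 1}" and ?N = "{\<omega> \<in> space M. z \<omega> $ i = - 1}"
    have [measurable]: "(\<lambda>\<omega>. z \<omega> $ i) \<in> borel_measurable M"
      using assms unfolding rademacher_vector_def indep_vars_def by auto
    have sets: "?P \<in> events" "?N \<in> events" by measurable
    have "?P \<inter> ?N = {}" by auto
    then have "prob (?P \<union> ?N) = prob ?P + prob ?N"
      using sets by (intro finite_measure_Union)
    also have "\<dots> = 1 / 2 + 1 / 2"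
      using assms unfolding rademacher_vector_def by metis
    finally have "prob (?P \<union> ?N) = 1" by simp
    then have "AE \<omega> in M. \<omega> \<in> ?P \<union> ?N"
      using sets by (subst (asm) prob_eq_1) auto
    then show ?thesis by (rule AE_mp) (intro AE_I2, auto)
  qed
  then show ?thesis by (simp add: AE_all_countable)
qed

lemma rademacher_inner_self_AE:
  fixes z :: "'a \<Rightarrow> real^'d"
  assumes "rademacher_vector M z"
  shows "AE \<omega> in M. z \<omega> \<bullet> z \<omega> = real CARD('d)"
  using rademacher_AE[OF assms]
proof (rule AE_mp, intro AE_I2 impI)
  fix \<omega> assume *: "\<forall>i. \<bar>z \<omega> $ i\<bar> = 1"
  have "z \<omega> $ i * z \<omega> $ i = 1" for i
    using *[rule_format, of i] abs_mult_self_eq[of "z \<omega> $ i"] by simp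
  then show "z \<omega> \<bullet> z \<omega> = real CARD('d)" by (simp add: inner_vec_def)
qed

text \<open>The form is a finite linear combination of products of two entries, each almost surely
  bounded by 1 in absolute value.\<close>

lemma rademacher_quadratic_form_integrable:
  fixes z :: "'a \<Rightarrow> real^'d" and B :: "real^'d^'d"
  assumes "rademacher_vector M z"
  shows "integrable M (\<lambda>\<omega>. z \<omega> \<bullet> (B *v z \<omega>))"
proof -
  have [measurable]: "(\<lambda>\<omega>. z \<omega> $ i) \<in> borel_measurable M" for i
    using assms unfolding rademacher_vector_def indep_vars_def by auto
  have "integrable M (\<lambda>\<omega>. z \<omega> $ i * z \<omega> $ j)" for i j
    using rademacher_AE[OF assms]
    by (intro integrable_const_bound[where B = 1]) (auto simp: abs_mult elim!: AE_mp)
  then have "integrable M (\<lambda>\<omega>. \<Sum>i\<in>UNIV. \<Sum>j\<in>UNIV. B $ i $ j * (z \<omega> $ i * z \<omega> $ j))"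
    by simp
  then show ?thesis
    by (simp add: inner_vec_def matrix_vector_mult_def sum_distrib_left mult_ac)
qed

lemma level_diff_integrable:
  assumes "rademacher_vector M z"
  shows "integrable M (level_diff c A z l' l)"
  unfolding level_diff_def[abs_def]
  by (intro Bochner_Integration.integrable_sum integrable_mult_right
      rademacher_quadratic_form_integrable assms)

lemma level_var_bottom:
  fixes z :: "'a \<Rightarrow> real^'d"
  assumes z: "rademacher_vector M z" and "0 \<le> l"
  shows "level_var M c A z (- 1) l = level_var M c A z 0 l"
  unfolding level_var_def
proof (rule variance_add_const_AE)
  show "integrable M (level_diff c A z 0 l)" by (rule level_diff_integrable[OF z])
  show "level_diff c A z (- 1) l \<in> borel_measurable M"
    using level_diff_integrable[OF z] by blast
  \<comment> \<open>The sum over the jump from \<open>l'\<close> starts at \<open>l' + 1\<close>, so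
    starting at -1 rather than 0 adds exactly the term for j = 0.\<close>
  have "{0..l} = insert 0 {1..l}" using \<open>0 \<le> l\<close> by auto
  then have "level_diff c A z (- 1) l \<omega> = c 0 * (z \<omega> \<bullet> z \<omega>) + level_diff c A z 0 l \<omega>" for \<omega>
    by (simp add: level_diff_def poly_mat_1)
  then show "AE \<omega> in M. level_diff c A z (- 1) l \<omega> =
      c 0 * real CARD('d) + level_diff c A z 0 l \<omega>"
    using rademacher_inner_self_AE[OF z] by simp
qed

end

theorem theorem3p1:
  fixes M :: "'w measure"
    and A :: "real^'d^'d"
    and n :: nat
    and c :: "nat \<Rightarrow> real"
    and z :: "'w \<Rightarrow> real^'d"
    and V C :: "int \<Rightarrow> int \<Rightarrow> real"
    and \<C> :: "int \<Rightarrow> real"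
  assumes prob: "prob_space M"
    and sym: "transpose A = A"
    and rademacher: "rademacher_vector M z"
    and V: "\<And>l' l. - 1 \<le> l' \<Longrightarrow> l' < l \<Longrightarrow> l \<le> int n \<Longrightarrow> V l' l = level_var M c A z l' l"
    and cost: "(\<forall>l' l. - 1 \<le> l' \<and> l' < l \<and> l \<le> int n \<longrightarrow> C l' l = of_int l) \<or>
               (\<forall>l' l. - 1 \<le> l' \<and> l' < l \<and> l \<le> int n \<longrightarrow> C l' l = of_int \<lceil>real_of_int l / 2\<rceil>)"
    and opt: "\<And>l. 0 \<le> l \<Longrightarrow> l \<le> int n \<Longrightarrow> \<C> l = opt_cost V C l"
  shows "\<forall>l\<in>{0..int n}.
           \<C> l = (if l = 0 then 0
                  else Min ((\<lambda>l'. \<C> l' + sqrt (V l' l * C l' l)) ` {0..<l}))"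
proof
  fix l assume l: "l \<in> {0..int n}"
  define w where "w = (\<lambda>i j. sqrt (V i j * C i j))"
  have opt': "\<C> k = Min (path_costs w k)" if "0 \<le> k" "k \<le> int n" for k
    using opt[OF that] by (simp add: opt_cost_eq w_def)
  \<comment> \<open>Both cost models vanish at target level 0, so the first edge is free whatever
    its variance.\<close>
  have "C (- 1) 0 = 0" using cost by auto
  then have w0: "w (- 1) 0 = 0" by (simp add: w_def)
  show "\<C> l = (if l = 0 then 0
                  else Min ((\<lambda>l'. \<C> l' + sqrt (V l' l * C l' l)) ` {0..<l}))"
  proof (cases "l = 0")
    case True
    then show ?thesis using opt'[of 0] w0 by (simp add: Min_path_costs_0)
  next
    case False
    with l have "0 < l" "l \<le> int n" by auto
    have "V (- 1) l = V 0 l"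
      using V \<open>0 < l\<close> \<open>l \<le> int n\<close> prob_space.level_var_bottom[OF prob rademacher, of l] by simp
    \<comment> \<open>In both models the cost depends on the target level alone.\<close>
    moreover have "C (- 1) l = C 0 l"
      using cost \<open>0 < l\<close> \<open>l \<le> int n\<close> by auto
    ultimately have "w (- 1) 0 + w 0 l \<le> w (- 1) l"
      unfolding w0 by (simp add: w_def)
    then have "\<C> l = Min ((\<lambda>l'. Min (path_costs w l') + w l' l) ` {0..<l})"
      using opt' Min_path_costs_rec[OF \<open>0 < l\<close>, of w] \<open>0 < l\<close> \<open>l \<le> int n\<close> by simp
    also have "(\<lambda>l'. Min (path_costs w l') + w l' l) ` {0..<l} =
        (\<lambda>l'. \<C> l' + sqrt (V l' l * C l' l)) ` {0..<l}"
      using \<open>l \<le> int n\<close> by (intro image_cong) (auto simp: opt' w_def)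
    finally show ?thesis using False by simp
  qed
qed

end
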